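(* Let $\rho_1,\rho_2$ be convex expectations on $L^\infty(\mu)$ that are continuous from above. Then there exist two constants $u>\max\{0,M-\rho_1(0)+1\}$ and $v>\max\{0,M-\rho_2(0)+1\}$ such that $\mathcal{G}_u$ and $\mathcal{H}_v$ are both closed under $\mu$-a.e. convergence.
   Context: $(\Omega,\mathcal{F},\mu)$ is a probability space and $\mathcal{M}$ is the set of probability measures on $(\Omega,\mathcal{F})$ absolutely continuous with respect to $\mu$. For $P,Q\in\mathcal{M}$ write $G_P=\frac{dP}{d\mu}$ and $H_Q=\frac{dQ}{d\mu}$. A convex expectation on $L^\infty(\mu)$ is a map $\rho:L^\infty(\mu)\to\mathbb{R}$ such that for all $X,Y\in L^\infty(\mu)$: (i) $X\ge Y$ implies $\rho(X)\ge\rho(Y)$; (ii) $\rho(X+c)=\rho(X)+c$ for every constant $c$; (iii) $\rho(\lambda X+(1-\lambda)Y)\le\lambda\rho(X)+(1-\lambda)\rho(Y)$ for $\lambda\in[0,1]$. It is continuous from above if $\rho(X_n)\to\rho(X)$ whenever $(X_n)\subset L^\infty(\mu)$ decreases to $X\in L^\infty(\mu)$. The penalty function is $\rho^*(P)=\sup_{X\in L^\infty(\mu)}(E_P[X]-\rho(X))$ for $P\in\mathcal{M}$. $\mathcal{P}=\{P\in\mathcal{M}:\rho_1^*(P)<\infty\}$, $\mathcal{Q}=\{Q\in\mathcal{M}:\rho_2^*(Q)<\infty\}$, and for a constant $c$, $\mathcal{G}_c=\{G_P:P\in\mathcal{P},\ \rho_1^*(P)\le c\}$, $\mathcal{H}_c=\{H_Q:Q\in\mathcal{Q},\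 \rho_2^*(Q)\le c\}$. A set of random variables is closed under $\mu$-a.e. convergence if the $\mu$-a.e. limit of any $\mu$-a.e. convergent sequence in it belongs to it. $K_1,K_2\in L^\infty(\mu)$ are fixed with $0\le K_1<K_2$ ($\mu$-a.e.), and $M$ is the least (essential) upper bound of $K_1$ and $K_2$. *)

theory Defs
  imports "HOL-Probability.Probability"
begin

text \<open>
  Elements of \<open>L\<^sup>\<infinity>(\<mu>)\<close> are represented by functions rather than by classes modulo \<open>\<mu>\<close>-null sets;
  all (in)equalities and limits between random variables are therefore \<open>\<mu>\<close>-almost everywhere.
\<close>

definition Linfty :: "'a measure \<Rightarrow> ('a \<Rightarrow> real) set" where
  "Linfty \<mu> = {X \<in> borel_measurable \<mu>. \<exists>C. AE x in \<mu>. \<bar>X x\<bar> \<le> C}"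

text \<open>
  Only the values of \<open>\<rho>\<close> on \<open>Linfty \<mu>\<close> matter. Monotonicity for the a.e. order makes \<open>\<rho>\<close> agree
  on a.e. equal functions, so \<open>\<rho>\<close> is a functional on the classes.
\<close>

definition convex_expectation :: "'a measure \<Rightarrow> (('a \<Rightarrow> real) \<Rightarrow> real) \<Rightarrow> bool" where
  "convex_expectation \<mu> \<rho> \<longleftrightarrow>
     (\<forall>X\<in>Linfty \<mu>. \<forall>Y\<in>Linfty \<mu>. (AE x in \<mu>. X x \<ge> Y x) \<longrightarrow> \<rho> X \<ge> \<rho> Y) \<and>
     (\<forall>X\<in>Linfty \<mu>. \<forall>c::real. \<rho> (\<lambda>x. X x + c) = \<rho> X + c) \<and>
     (\<forall>X\<in>Linfty \<mu>. \<forall>Y\<in>Linfty \<mu>. \<forall>l\<in>{0..1::real}.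
        \<rho> (\<lambda>x. l * X x + (1 - l) * Y x) \<le> l * \<rho> X + (1 - l) * \<rho> Y)"

definition continuous_from_above :: "'a measure \<Rightarrow> (('a \<Rightarrow> real) \<Rightarrow> real) \<Rightarrow> bool" where
  "continuous_from_above \<mu> \<rho> \<longleftrightarrow>
     (\<forall>X Y. (\<forall>n::nat. X n \<in> Linfty \<mu>) \<and> Y \<in> Linfty \<mu> \<and>
        (AE x in \<mu>. decseq (\<lambda>n. X n x)) \<and> (AE x in \<mu>. (\<lambda>n. X n x) \<longlonglongrightarrow> Y x) \<longrightarrow>
        (\<lambda>n. \<rho> (X n)) \<longlonglongrightarrow> \<rho> Y)"

definition ac_prob_measures :: "'a measure \<Rightarrow> 'a measure set" where
  "ac_prob_measures \<mu> = {P. prob_space P \<and> sets P = sets \<mu> \<and> absolutely_continuous \<mu> P}"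

definition penalty :: "'a measure \<Rightarrow> (('a \<Rightarrow> real) \<Rightarrow> real) \<Rightarrow> 'a measure \<Rightarrow> ereal" where
  "penalty \<mu> \<rho> P = (SUP X\<in>Linfty \<mu>. ereal ((LINT x|P. X x) - \<rho> X))"

definition finite_penalty_measures ::
  "'a measure \<Rightarrow> (('a \<Rightarrow> real) \<Rightarrow> real) \<Rightarrow> 'a measure set" where
  "finite_penalty_measures \<mu> \<rho> = {P \<in> ac_prob_measures \<mu>. penalty \<mu> \<rho> P < \<infinity>}"

text \<open>
  The sets \<open>\<G>\<^sub>c\<close> (for \<open>\<rho>\<^sub>1\<close>) and \<open>\<H>\<^sub>c\<close> (for \<open>\<rho>\<^sub>2\<close>). A density is determined only up to a \<open>\<mu>\<close>-null set,
  so all real-valued versions of the (a.e. finite) Radon-Nikodym derivative are included.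
\<close>

definition penalty_densities ::
  "'a measure \<Rightarrow> (('a \<Rightarrow> real) \<Rightarrow> real) \<Rightarrow> real \<Rightarrow> ('a \<Rightarrow> real) set" where
  "penalty_densities \<mu> \<rho> c =
     {G \<in> borel_measurable \<mu>. \<exists>P \<in> finite_penalty_measures \<mu> \<rho>.
        penalty \<mu> \<rho> P \<le> ereal c \<and> (AE x in \<mu>. G x = enn2real (RN_deriv \<mu> P x))}"

definition closed_under_AE_convergence :: "'a measure \<Rightarrow> ('a \<Rightarrow> real) set \<Rightarrow> bool" where
  "closed_under_AE_convergence \<mu> S \<longleftrightarrow>
     (\<forall>X Y. (\<forall>n::nat. X n \<in> S) \<and> Y \<in> borel_measurable \<mu> \<and>
        (AE x in \<mu>. (\<lambda>n. X n x) \<longlonglongrightarrow> Y x) \<longrightarrow> Y \<in> S)"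

text \<open>
  The least constant bounding both functions almost everywhere; \<^const>\<open>esssup\<close> needs a complete
  linear order, hence the detour through \<^typ>\<open>ereal\<close>. Its value is finite for \<open>K\<^sub>1\<close>, \<open>K\<^sub>2\<close> in
  \<open>Linfty \<mu>\<close> when \<open>\<mu>\<close> is a probability measure.
\<close>

definition least_ess_upper_bound :: "'a measure \<Rightarrow> ('a \<Rightarrow> real) \<Rightarrow> ('a \<Rightarrow> real) \<Rightarrow> real" where
  "least_ess_upper_bound \<mu> K\<^sub>1 K\<^sub>2 =
     real_of_ereal (esssup \<mu> (\<lambda>x. ereal (max (K\<^sub>1 x) (K\<^sub>2 x))))"

end

theory Submission
  imports Defs
begin

text \<open>
  Every sublevel set of the penalty is closed under a.e. convergence, so any \<open>u\<close> and \<open>v\<close> above the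
  prescribed bounds will do. By \<open>penalty_densities_iff\<close>, a density \<open>G\<close> lies in the set of level \<open>c\<close>
  exactly when it is nonnegative, has integral \<open>1\<close>, and satisfies \<open>E[G X] \<le> \<rho> X + c\<close> for every
  bounded \<open>X\<close>. Let densities \<open>G n\<close> of level \<open>c\<close> tend a.e. to \<open>Y\<close>. Nonnegativity passes to the limit,
  and the two integral conditions remain.

  The only obstruction is escape of mass, and continuity from above excludes it: if measurable sets
  \<open>A k\<close> decrease to a null set, then for every \<open>l > 0\<close> the bound \<open>l E[G 1\<^bsub>A k\<^esub>] \<le> \<rho> (l 1\<^bsub>A k\<^esub>) + c\<close>
  has a right-hand side that tends to \<open>\<rho> 0 + c\<close> and does not involve \<open>G\<close>. Dividing by a large \<open>l\<close>
  makes \<open>E[G 1\<^bsub>A k\<^esub>]\<close> small for all \<open>G\<close> of level \<open>c\<close> at once (\<open>penalty_densities_uniformly_small\<close>).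
  With \<open>A k\<close> the set where some \<open>G n\<close> exceeds \<open>k\<close>, the sequence is bounded off \<open>A k\<close>, and dominated
  convergence there yields \<open>E[Y] = 1\<close> (\<open>integral_AE_limit_eq_1\<close>). For \<open>\<bar>X\<bar> \<le> C\<close>, Fatou's lemma applied
  to the nonnegative \<open>G n (X + C)\<close> then gives \<open>E[Y X] + C \<le> \<rho> X + c + C\<close>; the terms \<open>C\<close> cancel because
  no mass was lost.
\<close>

section \<open>Densities of bounded penalty\<close>

text \<open>
  The Radon-Nikodym correspondence eliminates the measure: what remains are conditions on the
  density alone, stated on one fixed space, so that Fatou's lemma and dominated convergence apply.
\<close>

lemma (in prob_space) penalty_densities_iff:
  "G \<in> penalty_densities M \<rho> c \<longleftrightarrow>
     G \<in> borel_measurable M \<and> (AE x in M. 0 \<le> G x) \<and> integrable M G \<and> (LINT x|M. G x) = 1 \<and>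
     (\<forall>X\<in>Linfty M. (LINT x|M. G x * X x) \<le> \<rho> X + c)" (is "?L \<longleftrightarrow> ?R")
proof
  assume ?L
  then obtain P where G [measurable]: "G \<in> borel_measurable M"
    and P: "prob_space P" "sets P = sets M" "absolutely_continuous M P"
    and pen: "penalty M \<rho> P \<le> ereal c"
    and GP: "AE x in M. G x = enn2real (RN_deriv M P x)"
    by (auto simp: penalty_densities_def finite_penalty_measures_def ac_prob_measures_def)
  interpret P: prob_space P by fact
  have pos: "AE x in M. 0 \<le> G x"
    using GP by eventually_elim simp
  have "AE x in M. RN_deriv M P x \<noteq> \<infinity>"
    by (rule RN_deriv_finite) (use P P.sigma_finite_measure_axioms in auto)
  with GP have eq: "AE x in M. ennreal (G x) = RN_deriv M P x"
    by eventually_elim (auto simp: less_top)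
  have "density M (\<lambda>x. ennreal (G x)) = density M (RN_deriv M P)"
    using eq by (intro density_cong) auto
  then have dens: "density M (\<lambda>x. ennreal (G x)) = P"
    using density_RN_deriv[OF P(3,2)] by simp
  have "(\<integral>\<^sup>+x. ennreal (G x) \<partial>M) = emeasure (density M (\<lambda>x. ennreal (G x))) (space M)"
    by (simp add: emeasure_density cong: nn_integral_cong)
  also have "\<dots> = 1"
    unfolding dens using P.emeasure_space_1 sets_eq_imp_space_eq[OF P(2)] by simp
  finally have one: "(\<integral>\<^sup>+x. ennreal (G x) \<partial>M) = 1" .
  have bound: "(LINT x|M. G x * X x) \<le> \<rho> X + c" if "X \<in> Linfty M" for X
  proof -
    have [measurable]: "X \<in> borel_measurable M"
      using that by (simp add: Linfty_def)
    have "ereal ((LINT x|P. X x) - \<rho> X) \<le> penalty M \<rho> P"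
      unfolding penalty_def by (rule SUP_upper) fact
    then have "(LINT x|P. X x) - \<rho> X \<le> c"
      using pen by (metis ereal_less_eq(3) order_trans)
    then show ?thesis
      unfolding dens[symmetric] by (simp add: integral_density pos)
  qed
  show ?R
    using one pos bound by (auto intro!: integrableI_nonneg simp: integral_eq_nn_integral)
next
  assume R: ?R
  then have G [measurable]: "G \<in> borel_measurable M" and pos: "AE x in M. 0 \<le> G x"
    and int: "integrable M G" "(LINT x|M. G x) = 1"
    and bound: "\<And>X. X \<in> Linfty M \<Longrightarrow> (LINT x|M. G x * X x) \<le> \<rho> X + c"
    by auto
  define P where "P = density M (\<lambda>x. ennreal (G x))"
  have "(\<integral>\<^sup>+x. ennreal (G x) \<partial>M) = 1"
    using nn_integral_eq_integral[OF int(1) pos] int(2) by simp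
  then have "prob_space P"
    by (intro prob_spaceI) (simp add: P_def emeasure_density cong: nn_integral_cong)
  then have P: "P \<in> ac_prob_measures M"
    by (simp add: P_def ac_prob_measures_def absolutely_continuousI_density)
  have pen: "penalty M \<rho> P \<le> ereal c"
    unfolding penalty_def
  proof (rule SUP_least)
    fix X assume X: "X \<in> Linfty M"
    then have [measurable]: "X \<in> borel_measurable M"
      by (simp add: Linfty_def)
    show "ereal ((LINT x|P. X x) - \<rho> X) \<le> ereal c"
      using bound[OF X] by (simp add: P_def integral_density pos)
  qed
  have "AE x in M. ennreal (G x) = RN_deriv M P x"
    by (rule RN_deriv_unique) (auto simp: P_def)
  with pos have "AE x in M. G x = enn2real (RN_deriv M P x)"
    by eventually_elim (metis enn2real_ennreal)
  moreover have "penalty M \<rho> P < \<infinity>"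
    using pen by (auto simp: less_top[symmetric])
  ultimately show ?L
    using P pen by (auto simp: penalty_densities_def finite_penalty_measures_def)
qed

section \<open>Uniform integrability\<close>

text \<open>
  Uniform integrability of a sublevel set, in the form of small integrals over sets that shrink to a
  null set. The scale \<open>l\<close> of the test functions is chosen before the index \<open>k\<close>.
\<close>

lemma (in prob_space) penalty_densities_uniformly_small:
  assumes cont: "continuous_from_above M \<rho>"
    and A [measurable]: "\<And>k. A k \<in> sets M" and "decseq A"
    and null: "AE x in M. \<exists>k. x \<notin> A k" and "0 < e"
  obtains k :: nat where
    "\<And>G. G \<in> penalty_densities M \<rho> c \<Longrightarrow> (LINT x|M. G x * indicator (A k) x) \<le> e"
proof -
  \<comment> \<open>The additional \<open>1\<close> is the room for \<open>\<rho> (X k)\<close> above its limit \<open>\<rho> 0\<close>; the absolute value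
      makes \<open>l\<close> positive even when \<open>\<rho> 0 + c\<close> is not.\<close>
  define l where "l = (\<bar>\<rho> (\<lambda>_. 0) + c\<bar> + 1) / e"
  have l: "0 < l" "\<rho> (\<lambda>_. 0) + c + 1 \<le> l * e"
    using \<open>0 < e\<close> by (auto simp: l_def intro!: divide_pos_pos)
  define X where "X k x = l * indicator (A k) x" for k x
  have X: "X k \<in> Linfty M" for k
    unfolding Linfty_def X_def using l(1)
    by (auto intro!: exI[of _ l] simp: indicator_def)
  have zero: "(\<lambda>_. 0) \<in> Linfty M"
    by (auto simp: Linfty_def)
  have dec: "decseq (\<lambda>k. X k x)" for x
    using \<open>decseq A\<close> l(1) by (fastforce simp: decseq_def X_def indicator_def)
  have lim: "AE x in M. (\<lambda>k. X k x) \<longlonglongrightarrow> 0"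
    using null
  proof eventually_elim
    case (elim x)
    then obtain k where k: "x \<notin> A k" by blast
    have "x \<notin> A j" if "k \<le> j" for j
      using k decseqD[OF \<open>decseq A\<close> that] by blast
    then have "\<forall>\<^sub>F j in sequentially. X j x = 0"
      by (auto simp: eventually_sequentially X_def intro!: exI[of _ k])
    then show ?case
      by (rule tendsto_eventually)
  qed
  have "(\<lambda>k. \<rho> (X k)) \<longlonglongrightarrow> \<rho> (\<lambda>_. 0)"
    using cont X zero dec lim unfolding continuous_from_above_def by blast
  then have "\<forall>\<^sub>F k in sequentially. \<rho> (X k) < \<rho> (\<lambda>_. 0) + 1"
    by (rule order_tendstoD) simp
  then obtain k where k: "\<rho> (X k) < \<rho> (\<lambda>_. 0) + 1"
    by (auto simp: eventually_sequentially)
  show thesis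
  proof (rule that[of k])
    fix G assume "G \<in> penalty_densities M \<rho> c"
    then have "(LINT x|M. G x * X k x) \<le> \<rho> (X k) + c"
      using X by (simp add: penalty_densities_iff)
    also have "(LINT x|M. G x * X k x) = (LINT x|M. l * (G x * indicator (A k) x))"
      by (simp add: X_def mult_ac)
    finally have "l * (LINT x|M. G x * indicator (A k) x) \<le> l * e"
      using k l(2) by simp
    then show "(LINT x|M. G x * indicator (A k) x) \<le> e"
      using l(1) by simp
  qed
qed

section \<open>Almost everywhere limits\<close>

lemma integral_AE_limit_le:
  fixes f :: "'a \<Rightarrow> real" and F :: "nat \<Rightarrow> 'a \<Rightarrow> real"
  assumes int: "\<And>n. integrable M (F n)" and [measurable]: "f \<in> borel_measurable M"
    and pos: "\<And>n. AE x in M. 0 \<le> F n x"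
    and lim: "AE x in M. (\<lambda>n. F n x) \<longlonglongrightarrow> f x"
    and le: "\<And>n. (LINT x|M. F n x) \<le> B"
  shows "integrable M f" "(LINT x|M. f x) \<le> B"
proof -
  have [measurable]: "F n \<in> borel_measurable M" for n
    using int by simp
  have "AE x in M. \<forall>n. 0 \<le> F n x"
    using pos by (simp add: AE_all_countable)
  then have pos': "AE x in M. 0 \<le> f x"
    using lim by eventually_elim (auto intro: LIMSEQ_le_const)
  have "0 \<le> B"
    using integral_nonneg_AE[OF pos[of 0]] le[of 0] by simp
  have "(\<integral>\<^sup>+x. ennreal (f x) \<partial>M) = (\<integral>\<^sup>+x. liminf (\<lambda>n. ennreal (F n x)) \<partial>M)"
  proof (rule nn_integral_cong_AE)
    show "AE x in M. ennreal (f x) = liminf (\<lambda>n. ennreal (F n x))"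
      using lim
    proof eventually_elim
      case (elim x)
      then have "(\<lambda>n. ennreal (F n x)) \<longlonglongrightarrow> ennreal (f x)"
        by (rule tendsto_ennrealI)
      from lim_imp_Liminf[OF _ this] show ?case
        by simp
    qed
  qed
  also have "\<dots> \<le> liminf (\<lambda>n. \<integral>\<^sup>+x. ennreal (F n x) \<partial>M)"
    by (rule nn_integral_liminf) simp
  also have "\<dots> \<le> limsup (\<lambda>n. \<integral>\<^sup>+x. ennreal (F n x) \<partial>M)"
    by (rule Liminf_le_Limsup) simp
  also have "\<dots> \<le> ennreal B"
    by (rule Limsup_bounded)
       (auto simp: nn_integral_eq_integral[OF int pos] le intro!: always_eventually ennreal_leI)
  finally have nn: "(\<integral>\<^sup>+x. ennreal (f x) \<partial>M) \<le> ennreal B" .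
  then show f: "integrable M f"
    using pos' by (intro integrableI_nonneg) (auto intro: le_less_trans)
  show "(LINT x|M. f x) \<le> B"
    using nn \<open>0 \<le> B\<close> by (simp add: nn_integral_eq_integral[OF f pos'])
qed

text \<open>
  Fatou's lemma only bounds the mass of the limit by \<open>1\<close>; that no mass is lost comes from uniform
  smallness on the sets where the sequence is unboundedly large.
\<close>

lemma (in prob_space) integral_AE_limit_eq_1:
  assumes cont: "continuous_from_above M \<rho>"
    and G: "\<And>n. G n \<in> penalty_densities M \<rho> c"
    and Y [measurable]: "Y \<in> borel_measurable M"
    and lim: "AE x in M. (\<lambda>n. G n x) \<longlonglongrightarrow> Y x"
  shows "integrable M Y" "(LINT x|M. Y x) = 1"
proof -
  have Gm [measurable]: "G n \<in> borel_measurable M" and pos: "AE x in M. 0 \<le> G n x"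
    and int: "integrable M (G n)" and one: "(LINT x|M. G n x) = 1" for n
    using G[of n] by (simp_all add: penalty_densities_iff)
  have Y_int: "integrable M Y" and Y_le: "(LINT x|M. Y x) \<le> 1"
    using integral_AE_limit_le[OF int Y pos lim, of 1] one by auto
  have all_pos: "AE x in M. \<forall>n. 0 \<le> G n x"
    using pos by (simp add: AE_all_countable)
  then have Y_pos: "AE x in M. 0 \<le> Y x"
    using lim by eventually_elim (auto intro: LIMSEQ_le_const)
  define A where "A k = {x \<in> space M. \<exists>n. real k < G n x}" for k
  have A [measurable]: "A k \<in> sets M" for k
    unfolding A_def by measurable
  have "decseq A"
    by (auto simp: decseq_def A_def intro: le_less_trans of_nat_mono)
  have null: "AE x in M. \<exists>k. x \<notin> A k"
    using lim
  proof eventually_elim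
    case (elim x)
    then have "Bseq (\<lambda>n. G n x)"
      by (intro convergent_imp_Bseq convergentI)
    then obtain B where B: "\<And>n. \<bar>G n x\<bar> \<le> B"
      by (auto simp: Bseq_def)
    obtain k where k: "B \<le> real k"
      using real_arch_simple by blast
    have "G n x \<le> real k" for n
      using B[of n] k by linarith
    then have "x \<notin> A k"
      by (simp add: A_def not_less)
    then show ?case ..
  qed
  have "1 - e \<le> (LINT x|M. Y x)" if "0 < e" for e
  proof -
    obtain k where k: "\<And>n. (LINT x|M. G n x * indicator (A k) x) \<le> e"
      using penalty_densities_uniformly_small[OF cont A \<open>decseq A\<close> null \<open>0 < e\<close>] G by metis
    have split: "1 = (LINT x|M. G n x * indicator (A k) x)
        + (LINT x|M. G n x * indicator (space M - A k) x)" for n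
    proof -
      have "1 = (LINT x|M. G n x * indicator (A k) x + G n x * indicator (space M - A k) x)"
        unfolding one[of n, symmetric]
        by (rule Bochner_Integration.integral_cong) (auto simp: indicator_def)
      also have "\<dots> = (LINT x|M. G n x * indicator (A k) x)
          + (LINT x|M. G n x * indicator (space M - A k) x)"
        by (intro Bochner_Integration.integral_add integrable_real_mult_indicator int) auto
      finally show ?thesis .
    qed
    have "(\<lambda>n. LINT x|M. G n x * indicator (space M - A k) x)
        \<longlonglongrightarrow> (LINT x|M. Y x * indicator (space M - A k) x)"
    proof (rule integral_dominated_convergence[where w = "\<lambda>_. real k"])
      show "AE x in M. (\<lambda>n. G n x * indicator (space M - A k) x)
          \<longlonglongrightarrow> Y x * indicator (space M - A k) x"
        using lim by eventually_elim (rule tendsto_mult_right)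
      show "AE x in M. norm (G n x * indicator (space M - A k) x) \<le> real k" for n
        using pos[of n] by eventually_elim (auto simp: A_def indicator_def not_less)
    qed auto
    moreover have "1 - e \<le> (LINT x|M. G n x * indicator (space M - A k) x)" for n
      using split[of n] k[of n] by linarith
    ultimately have "1 - e \<le> (LINT x|M. Y x * indicator (space M - A k) x)"
      by (auto intro: LIMSEQ_le_const)
    also have "\<dots> \<le> (LINT x|M. Y x)"
    proof (rule integral_mono_AE)
      show "AE x in M. Y x * indicator (space M - A k) x \<le> Y x"
        using Y_pos by eventually_elim (auto simp: indicator_def)
    qed (auto intro!: Y_int integrable_real_mult_indicator)
    finally show ?thesis .
  qed
  then have "1 \<le> (LINT x|M. Y x) + e" if "0 < e" for e
    using that by (simp only: diff_le_eq)
  then have "1 \<le> (LINT x|M. Y x)"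
    by (rule field_le_epsilon)
  with Y_int Y_le show "integrable M Y" "(LINT x|M. Y x) = 1"
    by auto
qed

lemma (in prob_space) closed_penalty_densities:
  assumes cont: "continuous_from_above M \<rho>"
  shows "closed_under_AE_convergence M (penalty_densities M \<rho> c)"
  unfolding closed_under_AE_convergence_def
proof (intro allI impI, elim conjE)
  fix G Y
  assume "\<forall>n. G n \<in> penalty_densities M \<rho> c" and Y [measurable]: "Y \<in> borel_measurable M"
    and lim: "AE x in M. (\<lambda>n. G n x) \<longlonglongrightarrow> Y x"
  then have G: "G n \<in> penalty_densities M \<rho> c" for n
    by blast
  have [measurable]: "G n \<in> borel_measurable M" and pos: "AE x in M. 0 \<le> G n x"
    and int: "integrable M (G n)" and one: "(LINT x|M. G n x) = 1"
    and bound: "\<And>X. X \<in> Linfty M \<Longrightarrow> (LINT x|M. G n x * X x) \<le> \<rho> X + c" for n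
    using G[of n] by (simp_all add: penalty_densities_iff)
  note Y_int = integral_AE_limit_eq_1[OF cont G Y lim]
  have "AE x in M. \<forall>n. 0 \<le> G n x"
    using pos by (simp add: AE_all_countable)
  then have Y_pos: "AE x in M. 0 \<le> Y x"
    using lim by eventually_elim (auto intro: LIMSEQ_le_const)
  have "(LINT x|M. Y x * X x) \<le> \<rho> X + c" if X: "X \<in> Linfty M" for X
  proof -
    obtain C where [measurable]: "X \<in> borel_measurable M" and C: "AE x in M. \<bar>X x\<bar> \<le> C"
      using X by (auto simp: Linfty_def)
    have mult_int: "integrable M (\<lambda>x. H x * X x)" if H: "integrable M H" for H
    proof (rule Bochner_Integration.integrable_bound[of M "\<lambda>x. H x * C"])
      show "AE x in M. norm (H x * X x) \<le> norm (H x * C)"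
        using C
      proof eventually_elim
        case (elim x)
        then have "\<bar>H x\<bar> * \<bar>X x\<bar> \<le> \<bar>H x\<bar> * \<bar>C\<bar>"
          by (intro mult_left_mono) linarith+
        then show ?case
          by (simp only: real_norm_def abs_mult)
      qed
    qed (use H in auto)
    have shift: "(LINT x|M. H x * (X x + C)) = (LINT x|M. H x * X x) + C * (LINT x|M. H x)"
      if H: "integrable M H" for H
      using mult_int[OF H] H by (simp add: distrib_left mult.commute)
    \<comment> \<open>Adding \<open>C\<close> makes the integrands nonnegative, as Fatou's lemma requires; it costs exactly
        \<open>C\<close> on both sides because \<open>G n\<close> and \<open>Y\<close> have the same integral.\<close>
    have "(LINT x|M. Y x * (X x + C)) \<le> \<rho> X + c + C"
    proof (rule integral_AE_limit_le(2))
      show "integrable M (\<lambda>x. G n x * (X x + C))" for n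
        using mult_int[OF int[of n]] int[of n] by (simp add: distrib_left)
      show "AE x in M. 0 \<le> G n x * (X x + C)" for n
        using pos[of n] C by eventually_elim auto
      show "AE x in M. (\<lambda>n. G n x * (X x + C)) \<longlonglongrightarrow> Y x * (X x + C)"
        using lim by eventually_elim (rule tendsto_mult_right)
      show "(LINT x|M. G n x * (X x + C)) \<le> \<rho> X + c + C" for n
        using shift[OF int[of n]] one[of n] bound[OF X, of n] by simp
    qed simp
    then show ?thesis
      using shift[OF Y_int(1)] Y_int(2) by simp
  qed
  with Y_int Y_pos show "Y \<in> penalty_densities M \<rho> c"
    by (simp add: penalty_densities_iff)
qed

theorem proposition6p2:
  fixes \<mu> :: "'a measure" and \<rho>\<^sub>1 \<rho>\<^sub>2 :: "('a \<Rightarrow> real) \<Rightarrow> real"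
    and K\<^sub>1 K\<^sub>2 :: "'a \<Rightarrow> real" and M :: real
  assumes "prob_space \<mu>"
    and "K\<^sub>1 \<in> Linfty \<mu>" and "K\<^sub>2 \<in> Linfty \<mu>"
    and "AE x in \<mu>. 0 \<le> K\<^sub>1 x" and "AE x in \<mu>. K\<^sub>1 x < K\<^sub>2 x"
    and "M = least_ess_upper_bound \<mu> K\<^sub>1 K\<^sub>2"
    and "convex_expectation \<mu> \<rho>\<^sub>1" and "continuous_from_above \<mu> \<rho>\<^sub>1"
    and "convex_expectation \<mu> \<rho>\<^sub>2" and "continuous_from_above \<mu> \<rho>\<^sub>2"
  shows "\<exists>u v :: real.
           u > max 0 (M - \<rho>\<^sub>1 (\<lambda>_. 0) + 1) \<and> v > max 0 (M - \<rho>\<^sub>2 (\<lambda>_. 0) + 1) \<and>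
           closed_under_AE_convergence \<mu> (penalty_densities \<mu> \<rho>\<^sub>1 u) \<and>
           closed_under_AE_convergence \<mu> (penalty_densities \<mu> \<rho>\<^sub>2 v)"
proof -
  interpret prob_space \<mu> by fact
  let ?u = "\<lambda>\<rho>. max 0 (M - \<rho> (\<lambda>_. 0) + 1) + 1"
  have "max 0 (M - \<rho>\<^sub>1 (\<lambda>_. 0) + 1) < ?u \<rho>\<^sub>1" "max 0 (M - \<rho>\<^sub>2 (\<lambda>_. 0) + 1) < ?u \<rho>\<^sub>2"
    by simp_all
  moreover note closed_penalty_densities[OF assms(8), of "?u \<rho>\<^sub>1"]
    closed_penalty_densities[OF assms(10), of "?u \<rho>\<^sub>2"]
  ultimately show ?thesis
    by blast
qed

end
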